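(* For all integers $n \ge 1$ and $k \ge 1$, $$D(n,k) \le \frac{kn^2}{2} + \left(\frac{k}{2}-1\right)n + 1.$$
   Context: For integers $k,n\ge 1$, the generalised symmetric group $C_k \wr S_n$ is regarded as the subgroup of $GL_n(\mathbb{C})$ consisting of the matrices with exactly one non-zero entry in each row and each column, all of whose non-zero entries are $k$-th roots of unity. Let $V=\mathbb{C}^n$ be its natural representation, and for each integer $r\ge 0$ let $\chi_r$ be the character of $C_k\wr S_n$ on the symmetric power $\mathrm{Sym}^r V$. Define $D(n,k) = \dim_{\mathbb{C}} \mathrm{Span}_{\mathbb{C}}\{\chi_r : r \ge 0\}$, the dimension of the span inside the space of complex class functions on $C_k\wr S_n$. *)

theory Defs
  imports
    "HOL-Library.Poly_Mapping"
    "HOL-Library.Function_Algebras"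
    "Jordan_Normal_Form.Determinant"
    Complex_Main
begin

subsection \<open>The trace of an endomorphism of a subspace\<close>

text \<open>
  \<open>trace_on U T\<close> is the trace of an endomorphism \<open>T\<close> of a finite-dimensional subspace \<open>U\<close>,
  computed in some basis of \<open>U\<close>; the lemma \<open>trace_on_eq\<close> shows that the choice is immaterial.
\<close>

definition (in vector_space) trace_on :: "'b set \<Rightarrow> ('b \<Rightarrow> 'b) \<Rightarrow> 'a" where
  "trace_on U T = (let B = SOME B. independent B \<and> span B = U
                   in \<Sum>b\<in>B. representation B (T b) b)"

context vector_space
begin

lemma trace_basis_independent:
  assumes B: "independent B" "span B = U" "finite B"
    and C: "independent C" "span C = U" "finite C"
    and add: "\<And>x y. x \<in> U \<Longrightarrow> y \<in> U \<Longrightarrow> T (x + y) = T x + T y"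
    and scl: "\<And>c x. x \<in> U \<Longrightarrow> T (scale c x) = scale c (T x)"
    and closed: "\<And>x. x \<in> U \<Longrightarrow> T x \<in> U"
  shows "(\<Sum>b\<in>B. representation B (T b) b) = (\<Sum>c\<in>C. representation C (T c) c)"
proof -
  have BU: "b \<in> U" if "b \<in> B" for b using that B span_base by blast
  have CU: "c \<in> U" if "c \<in> C" for c using that C span_base by blast
  have U: "subspace U" using B subspace_span by blast
  have T0: "T 0 = 0" using scl[of 0 0] subspace_0[OF U] by simp
  have lin: "T (\<Sum>c\<in>C'. scale (f c) c) = (\<Sum>c\<in>C'. scale (f c) (T c))"
    if "finite C'" "C' \<subseteq> C" for f C'
    using that
  proof (induction C' rule: finite_induct)
    case empty
    then show ?case by (simp add: T0)
  next
    case (insert x F)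
    have "(\<Sum>c\<in>F. scale (f c) c) \<in> U"
      using insert.prems CU U by (intro subspace_sum subspace_scale) auto
    moreover have "scale (f x) x \<in> U" using insert.prems CU U by (intro subspace_scale) auto
    ultimately show ?case using insert CU by (simp add: add scl)
  qed
  have expB: "(\<Sum>b\<in>B. scale (representation B v b) b) = v" if "v \<in> U" for v
    using sum_representation_eq[OF B(1) _ B(3), of v] that B by simp
  have expC: "(\<Sum>c\<in>C. scale (representation C v c) c) = v" if "v \<in> U" for v
    using sum_representation_eq[OF C(1) _ C(3), of v] that C by simp
  have "(\<Sum>b\<in>B. representation B (T b) b)
      = (\<Sum>b\<in>B. representation B (T (\<Sum>c\<in>C. scale (representation C b c) c)) b)"
    by (intro sum.cong refl) (simp add: expC BU)
  also have "\<dots> = (\<Sum>b\<in>B. \<Sum>c\<in>C. representation C b c * representation B (T c) b)"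
  proof (intro sum.cong refl)
    fix b assume "b \<in> B"
    have "representation B (\<Sum>c\<in>C. scale (representation C b c) (T c)) b
        = (\<Sum>c\<in>C. representation B (scale (representation C b c) (T c)) b)"
      using B(1,2) CU closed U subspace_scale by (subst representation_sum) auto
    also have "\<dots> = (\<Sum>c\<in>C. representation C b c * representation B (T c) b)"
      using B(1,2) CU closed by (intro sum.cong refl, subst representation_scale) auto
    finally show "representation B (T (\<Sum>c\<in>C. scale (representation C b c) c)) b
        = (\<Sum>c\<in>C. representation C b c * representation B (T c) b)"
      using C(3) by (simp add: lin)
  qed
  also have "\<dots> = (\<Sum>c\<in>C. \<Sum>b\<in>B. representation B (T c) b * representation C b c)"
    by (subst sum.swap) (simp add: mult.commute)
  also have "\<dots> = (\<Sum>c\<in>C. representation C (\<Sum>b\<in>B. scale (representation B (T c) b) b) c)"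
  proof (intro sum.cong refl)
    fix c assume "c \<in> C"
    have "representation C (\<Sum>b\<in>B. scale (representation B (T c) b) b) c
        = (\<Sum>b\<in>B. representation C (scale (representation B (T c) b) b) c)"
      using C(1,2) BU U subspace_scale by (subst representation_sum) auto
    also have "\<dots> = (\<Sum>b\<in>B. representation B (T c) b * representation C b c)"
      using C(1,2) BU by (intro sum.cong refl, subst representation_scale) auto
    finally show "(\<Sum>b\<in>B. representation B (T c) b * representation C b c)
        = representation C (\<Sum>b\<in>B. scale (representation B (T c) b) b) c" by simp
  qed
  also have "\<dots> = (\<Sum>c\<in>C. representation C (T c) c)"
    by (intro sum.cong refl) (simp add: expB CU closed)
  finally show ?thesis .
qed

lemma trace_on_eq:
  assumes "independent B" "span B = U" "finite B"
    and "\<And>x y. x \<in> U \<Longrightarrow> y \<in> U \<Longrightarrow> T (x + y) = T x + T y"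
    and "\<And>c x. x \<in> U \<Longrightarrow> T (scale c x) = scale c (T x)"
    and "\<And>x. x \<in> U \<Longrightarrow> T x \<in> U"
  shows "trace_on U T = (\<Sum>b\<in>B. representation B (T b) b)"
proof -
  define C where "C = (SOME C. independent C \<and> span C = U)"
  have C: "independent C \<and> span C = U"
    unfolding C_def by (rule someI[of _ B]) (use assms in auto)
  have "finite C"
    using independent_span_bound[OF assms(3), of C] C assms(2) span_superset by blast
  then have "(\<Sum>c\<in>C. representation C (T c) c) = (\<Sum>b\<in>B. representation B (T b) b)"
    by (intro trace_basis_independent[where U = U]) (use assms C in auto)
  then show ?thesis by (simp add: trace_on_def C_def Let_def)
qed

end


subsection \<open>The generalised symmetric group\<close>

definition gen_sym_group :: "nat \<Rightarrow> nat \<Rightarrow> complex mat set" where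
  "gen_sym_group n k =
     {A \<in> carrier_mat n n.
        (\<forall>i<n. \<exists>!j. j < n \<and> A $$ (i, j) \<noteq> 0) \<and>
        (\<forall>j<n. \<exists>!i. i < n \<and> A $$ (i, j) \<noteq> 0) \<and>
        (\<forall>i<n. \<forall>j<n. A $$ (i, j) \<noteq> 0 \<longrightarrow> A $$ (i, j) ^ k = 1)}"


subsection \<open>Symmetric powers\<close>

text \<open>
  \<open>Sym\<^sup>r V\<close> is realised as the degree-\<open>r\<close> part of the symmetric algebra of \<open>V = \<complex>\<^sup>n\<close>, which is the
  polynomial algebra on the standard basis vectors \<open>e\<^sub>0, \<dots>, e\<^sub>n\<^sub>-\<^sub>1\<close>. The polynomial
  \<open>single \<alpha> 1\<close> is the monomial whose exponent of \<open>e\<^sub>i\<close> is \<open>lookup \<alpha> i\<close>.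
\<close>

abbreviation "single \<equiv> Poly_Mapping.single"
abbreviation "lookup \<equiv> Poly_Mapping.lookup"
abbreviation "keys \<equiv> Poly_Mapping.keys"

type_synonym cpoly = "(nat \<Rightarrow>\<^sub>0 nat) \<Rightarrow>\<^sub>0 complex"

definition sym_exponents :: "nat \<Rightarrow> nat \<Rightarrow> (nat \<Rightarrow>\<^sub>0 nat) set" where
  "sym_exponents n r = {\<alpha>. keys \<alpha> \<subseteq> {..<n} \<and> (\<Sum>i<n. lookup \<alpha> i) = r}"

definition sym_power :: "nat \<Rightarrow> nat \<Rightarrow> cpoly set" where
  "sym_power n r = {p. keys p \<subseteq> sym_exponents n r}"

definition poly_scale :: "complex \<Rightarrow> cpoly \<Rightarrow> cpoly" where
  "poly_scale c p = single 0 c * p"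

interpretation cpoly: vector_space poly_scale
  by unfold_locales
    (simp_all add: poly_scale_def algebra_simps mult_single single_add flip: mult.assoc)

text \<open>
  \<open>image_vec n A j\<close> is the vector \<open>A e\<^sub>j = \<Sum>i. A\<^sub>i\<^sub>j e\<^sub>i\<close>, and \<open>sym_map n A\<close> is its extension to an
  algebra endomorphism, i.e. \<open>sym_map n A (v\<^sub>1 \<cdots> v\<^sub>r) = (A v\<^sub>1) \<cdots> (A v\<^sub>r)\<close>.
\<close>

definition image_vec :: "nat \<Rightarrow> complex mat \<Rightarrow> nat \<Rightarrow> cpoly" where
  "image_vec n A j = (\<Sum>i<n. single (single i 1) (A $$ (i, j)))"

definition sym_map :: "nat \<Rightarrow> complex mat \<Rightarrow> cpoly \<Rightarrow> cpoly" where
  "sym_map n A p =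
     (\<Sum>\<alpha>\<in>keys p. poly_scale (lookup p \<alpha>) (\<Prod>j<n. image_vec n A j ^ lookup \<alpha> j))"


subsection \<open>Characters and the dimension of their span\<close>

text \<open>
  Functions on the group are represented as functions on all matrices that vanish off the group,
  so that two of them are equal as soon as they agree on the group.
\<close>

definition class_functions :: "nat \<Rightarrow> nat \<Rightarrow> (complex mat \<Rightarrow> complex) set" where
  "class_functions n k =
     {f. (\<forall>A. A \<notin> gen_sym_group n k \<longrightarrow> f A = 0) \<and>
         (\<forall>A\<in>gen_sym_group n k. \<forall>P\<in>gen_sym_group n k. \<forall>Q\<in>gen_sym_group n k.
            P * Q = 1\<^sub>m n \<longrightarrow> f (P * A * Q) = f A)}"

definition sym_char :: "nat \<Rightarrow> nat \<Rightarrow> nat \<Rightarrow> complex mat \<Rightarrow> complex" where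
  "sym_char n k r A =
     (if A \<in> gen_sym_group n k then cpoly.trace_on (sym_power n r) (sym_map n A) else 0)"

definition fun_scale :: "complex \<Rightarrow> ('a \<Rightarrow> complex) \<Rightarrow> 'a \<Rightarrow> complex" where
  "fun_scale c f = (\<lambda>x. c * f x)"

interpretation cfun: vector_space "fun_scale :: complex \<Rightarrow> ('a \<Rightarrow> complex) \<Rightarrow> 'a \<Rightarrow> complex"
  by unfold_locales (simp_all add: fun_scale_def fun_eq_iff algebra_simps)

definition char_span_dim :: "nat \<Rightarrow> nat \<Rightarrow> nat" where
  "char_span_dim n k = cfun.dim (cfun.span {sym_char n k r | r. True})"


subsection \<open>Well-definedness\<close>

lemma finite_sym_exponents: "finite (sym_exponents n r)"
proof -
  have "lookup ` sym_exponents n r \<subseteq> {f. \<forall>x. (x \<in> {..<n} \<longrightarrow> f x \<in> {..r}) \<and> (x \<notin> {..<n} \<longrightarrow> f x = 0)}"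
    by (auto simp: sym_exponents_def in_keys_iff intro: member_le_sum)
  moreover have "finite \<dots>" by (rule finite_set_of_finite_funs) auto
  ultimately have "finite (lookup ` sym_exponents n r)" by (rule finite_subset)
  then show ?thesis by (rule finite_imageD) (auto simp: inj_on_def)
qed

lemma lookup_poly_scale [simp]: "lookup (poly_scale c p) \<alpha> = c * lookup p \<alpha>"
proof -
  have "lookup (single 0 c * p) \<alpha> = Sum_any (\<lambda>l. c * lookup p \<alpha> when 0 = (l :: nat \<Rightarrow>\<^sub>0 nat))"
    unfolding lookup_mult lookup_single by (rule Sum_any.cong) (auto simp: when_def)
  then show ?thesis by (simp add: poly_scale_def)
qed

lemma poly_expand:
  assumes "finite S" "keys p \<subseteq> S"
  shows "(\<Sum>\<alpha>\<in>S. poly_scale (lookup p \<alpha>) (single \<alpha> 1)) = p"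
proof (rule poly_mapping_eqI)
  fix \<beta>
  have "lookup (\<Sum>\<alpha>\<in>S. poly_scale (lookup p \<alpha>) (single \<alpha> 1)) \<beta>
      = (\<Sum>\<alpha>\<in>S. if \<alpha> = \<beta> then lookup p \<alpha> else 0)"
    by (auto simp: lookup_sum lookup_single when_def intro!: sum.cong)
  also have "\<dots> = lookup p \<beta>" using assms by (auto simp: in_keys_iff)
  finally show "lookup (\<Sum>\<alpha>\<in>S. poly_scale (lookup p \<alpha>) (single \<alpha> 1)) \<beta> = lookup p \<beta>" .
qed

lemma inj_monomial: "inj_on (\<lambda>\<alpha>. single \<alpha> (1 :: complex)) S"
proof (rule inj_onI)
  fix x y :: 'a assume "single x (1 :: complex) = single y 1"
  then have "keys (single x (1 :: complex)) = keys (single y (1 :: complex))" by simp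
  then show "x = y" by simp
qed

lemma subspace_sym_power: "cpoly.subspace (sym_power n r)"
  by (auto simp: cpoly.subspace_def sym_power_def in_keys_iff lookup_add subset_eq)

lemma sym_power_basis:
  shows "cpoly.independent ((\<lambda>\<alpha>. single \<alpha> 1) ` sym_exponents n r)" (is "cpoly.independent ?B")
    and "cpoly.span ((\<lambda>\<alpha>. single \<alpha> 1) ` sym_exponents n r) = sym_power n r"
proof -
  have fin: "finite ?B" by (simp add: finite_sym_exponents)
  show "cpoly.independent ?B"
  proof (rule cpoly.independent_if_scalars_zero[OF fin])
    fix f :: "cpoly \<Rightarrow> complex" and x
    assume *: "(\<Sum>x\<in>?B. poly_scale (f x) x) = 0" and "x \<in> ?B"
    then obtain \<beta> where \<beta>: "\<beta> \<in> sym_exponents n r" "x = single \<beta> 1" by auto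
    have "0 = lookup (\<Sum>x\<in>?B. poly_scale (f x) x) \<beta>" by (simp add: *)
    also have "\<dots> = (\<Sum>\<alpha>\<in>sym_exponents n r. f (single \<alpha> 1) * lookup (single \<alpha> 1) \<beta>)"
      by (simp add: lookup_sum sum.reindex[OF inj_monomial])
    also have "\<dots> = (\<Sum>\<alpha>\<in>sym_exponents n r. if \<alpha> = \<beta> then f (single \<alpha> 1) else 0)"
      by (auto simp: lookup_single when_def intro!: sum.cong)
    also have "\<dots> = f x" using \<beta> by (simp add: finite_sym_exponents)
    finally show "f x = 0" by simp
  qed
  show "cpoly.span ?B = sym_power n r"
  proof
    show "cpoly.span ?B \<subseteq> sym_power n r"
      by (rule cpoly.span_minimal) (use subspace_sym_power in \<open>auto simp: sym_power_def\<close>)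
    show "sym_power n r \<subseteq> cpoly.span ?B"
    proof
      fix p assume "p \<in> sym_power n r"
      then have "p = (\<Sum>\<alpha>\<in>sym_exponents n r. poly_scale (lookup p \<alpha>) (single \<alpha> 1))"
        by (subst poly_expand) (auto simp: finite_sym_exponents sym_power_def)
      also have "\<dots> \<in> cpoly.span ?B"
        by (intro cpoly.span_sum cpoly.span_scale cpoly.span_base) auto
      finally show "p \<in> cpoly.span ?B" .
    qed
  qed
qed

lemma sym_map_superset:
  assumes "finite S" "keys p \<subseteq> S"
  shows "sym_map n A p =
    (\<Sum>\<alpha>\<in>S. poly_scale (lookup p \<alpha>) (\<Prod>j<n. image_vec n A j ^ lookup \<alpha> j))"
  unfolding sym_map_def using assms
  by (intro sum.mono_neutral_left) (auto simp: in_keys_iff)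

lemma sym_map_add: "sym_map n A (p + q) = sym_map n A p + sym_map n A q"
proof -
  let ?S = "keys p \<union> keys q"
  have "keys (p + q) \<subseteq> ?S" by (rule keys_add)
  then show ?thesis
    by (simp add: sym_map_superset[of ?S] lookup_add cpoly.scale_left_distrib sum.distrib)
qed

lemma sym_map_scale: "sym_map n A (poly_scale c p) = poly_scale c (sym_map n A p)"
proof -
  have "keys (poly_scale c p) \<subseteq> keys p" by (auto simp: in_keys_iff)
  then show ?thesis
    by (simp add: sym_map_superset[of "keys p"] cpoly.scale_sum_right)
qed

lemma sym_map_0 [simp]: "sym_map n A 0 = 0"
  by (simp add: sym_map_def)

lemma sym_map_sum: "sym_map n A (\<Sum>x\<in>S. f x) = (\<Sum>x\<in>S. sym_map n A (f x))"
  by (induction S rule: infinite_finite_induct) (simp_all add: sym_map_add)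

lemma sym_map_monomial:
  "sym_map n A (single \<alpha> 1) = (\<Prod>j<n. image_vec n A j ^ lookup \<alpha> j)"
  by (simp add: sym_map_def)

lemma sym_power_mult:
  assumes "p \<in> sym_power n r" "q \<in> sym_power n s"
  shows "p * q \<in> sym_power n (r + s)"
proof -
  have "a + b \<in> sym_exponents n (r + s)" if "a \<in> sym_exponents n r" "b \<in> sym_exponents n s" for a b
    using that keys_add[of a b] by (auto simp: sym_exponents_def lookup_add sum.distrib)
  then show ?thesis using assms keys_mult[of p q] by (fastforce simp: sym_power_def)
qed

lemma sym_power_1: "1 \<in> sym_power n 0"
  by (auto simp: sym_power_def sym_exponents_def)

lemma sym_power_pow: "p \<in> sym_power n r \<Longrightarrow> p ^ m \<in> sym_power n (m * r)"
  by (induction m) (auto simp: sym_power_1 intro: sym_power_mult)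

lemma sym_power_prod:
  "(\<And>i. i \<in> S \<Longrightarrow> f i \<in> sym_power n (g i)) \<Longrightarrow> (\<Prod>i\<in>S. f i) \<in> sym_power n (\<Sum>i\<in>S. g i)"
  by (induction S rule: infinite_finite_induct) (auto simp: sym_power_1 intro: sym_power_mult)

lemma image_vec_in: "image_vec n A j \<in> sym_power n 1"
  unfolding image_vec_def
proof (rule cpoly.subspace_sum[OF subspace_sym_power])
  fix i assume "i \<in> {..<n}"
  then show "single (single i 1) (A $$ (i, j)) \<in> sym_power n 1"
    by (auto simp: sym_power_def sym_exponents_def lookup_single when_def)
qed

lemma sym_map_closed:
  assumes "p \<in> sym_power n r"
  shows "sym_map n A p \<in> sym_power n r"
  unfolding sym_map_def
proof (intro cpoly.subspace_sum[OF subspace_sym_power] cpoly.subspace_scale[OF subspace_sym_power])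
  fix \<alpha> assume "\<alpha> \<in> keys p"
  then have \<alpha>: "(\<Sum>j<n. lookup \<alpha> j * 1) = r" using assms by (auto simp: sym_power_def sym_exponents_def)
  show "(\<Prod>j<n. image_vec n A j ^ lookup \<alpha> j) \<in> sym_power n r"
    unfolding \<alpha>[symmetric] by (intro sym_power_prod sym_power_pow image_vec_in)
qed

lemma trace_sym_map:
  "cpoly.trace_on (sym_power n r) (sym_map n A)
     = (\<Sum>\<alpha>\<in>sym_exponents n r. lookup (sym_map n A (single \<alpha> 1)) \<alpha>)"
proof -
  let ?B = "(\<lambda>\<alpha>. single \<alpha> (1 :: complex)) ` sym_exponents n r"
  have rep: "cpoly.representation ?B p (single \<alpha> 1) = lookup p \<alpha>"
    if "p \<in> sym_power n r" "\<alpha> \<in> sym_exponents n r" for p \<alpha>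
  proof -
    have "cpoly.representation ?B (\<Sum>\<beta>\<in>sym_exponents n r. poly_scale (lookup p \<beta>) (single \<beta> 1)) (single \<alpha> 1)
        = (\<Sum>\<beta>\<in>sym_exponents n r. cpoly.representation ?B (poly_scale (lookup p \<beta>) (single \<beta> 1)) (single \<alpha> 1))"
      by (subst cpoly.representation_sum)
        (auto simp: sym_power_basis(1) intro!: cpoly.span_scale intro: cpoly.span_base)
    also have "\<dots> = (\<Sum>\<beta>\<in>sym_exponents n r. if \<beta> = \<alpha> then lookup p \<beta> else 0)"
    proof (intro sum.cong refl)
      fix \<beta> assume \<beta>: "\<beta> \<in> sym_exponents n r"
      have "cpoly.representation ?B (poly_scale (lookup p \<beta>) (single \<beta> 1)) (single \<alpha> 1)
          = lookup p \<beta> * cpoly.representation ?B (single \<beta> 1) (single \<alpha> 1)"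
        by (subst cpoly.representation_scale)
          (use \<beta> in \<open>auto simp: sym_power_basis(1) intro!: cpoly.span_base\<close>)
      also have "cpoly.representation ?B (single \<beta> 1) (single \<alpha> 1)
          = (if single \<beta> (1 :: complex) = single \<alpha> 1 then 1 else 0)"
        by (subst cpoly.representation_basis) (use \<beta> in \<open>auto simp: sym_power_basis(1)\<close>)
      also have "(single \<beta> (1 :: complex) = single \<alpha> 1) = (\<beta> = \<alpha>)"
        using inj_monomial[of UNIV] by (auto dest: injD)
      finally show "cpoly.representation ?B (poly_scale (lookup p \<beta>) (single \<beta> 1)) (single \<alpha> 1)
          = (if \<beta> = \<alpha> then lookup p \<beta> else 0)" by simp
    qed
    also have "\<dots> = lookup p \<alpha>" using that by (simp add: finite_sym_exponents)
    finally show ?thesis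
      using that by (simp add: poly_expand finite_sym_exponents sym_power_def)
  qed
  have in_pow: "sym_map n A (single \<alpha> 1) \<in> sym_power n r" if "\<alpha> \<in> sym_exponents n r" for \<alpha>
    using that by (intro sym_map_closed) (auto simp: sym_power_def)
  have "cpoly.trace_on (sym_power n r) (sym_map n A)
      = (\<Sum>b\<in>?B. cpoly.representation ?B (sym_map n A b) b)"
    by (rule cpoly.trace_on_eq)
      (auto simp: sym_power_basis finite_sym_exponents sym_map_add sym_map_scale sym_map_closed)
  also have "\<dots> = (\<Sum>\<alpha>\<in>sym_exponents n r. lookup (sym_map n A (single \<alpha> 1)) \<alpha>)"
    by (simp add: sum.reindex[OF inj_monomial] rep in_pow)
  finally show ?thesis .
qed

lemma sym_map_mult: "sym_map n A (p * q) = sym_map n A p * sym_map n A q"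
proof -
  have mono: "sym_map n A (single \<alpha> 1 * single \<beta> 1) = sym_map n A (single \<alpha> 1) * sym_map n A (single \<beta> 1)"
    for \<alpha> \<beta>
    by (simp add: mult_single sym_map_monomial lookup_add power_add prod.distrib)
  have scl: "poly_scale c x * poly_scale d y = poly_scale (c * d) (x * y)" for c d x y
  proof -
    have "single 0 (c * d) = single 0 c * (single 0 d :: cpoly)" by (simp add: mult_single)
    then show ?thesis by (simp add: poly_scale_def mult_ac)
  qed
  define E where "E p = (\<Sum>\<alpha>\<in>keys p. poly_scale (lookup p \<alpha>) (single \<alpha> (1 :: complex)))" for p :: cpoly
  have E: "E p = p" for p unfolding E_def by (rule poly_expand) auto
  have "sym_map n A (E p * E q) = sym_map n A (E p) * sym_map n A (E q)"
    unfolding E_def sum_product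
    by (simp add: sym_map_sum scl sym_map_scale mono sum_product)
  then show ?thesis by (simp add: E)
qed

lemma sym_map_1 [simp]: "sym_map n A 1 = 1"
  by (simp add: sym_map_def lookup_one)

lemma sym_map_pow: "sym_map n A (p ^ m) = sym_map n A p ^ m"
  by (induction m) (simp_all add: sym_map_mult)

lemma sym_map_prod: "sym_map n A (\<Prod>x\<in>S. f x) = (\<Prod>x\<in>S. sym_map n A (f x))"
  by (induction S rule: infinite_finite_induct) (simp_all add: sym_map_mult)

lemma sym_map_var:
  assumes "i < n"
  shows "sym_map n A (single (single i 1) 1) = image_vec n A i"
proof -
  have "sym_map n A (single (single i 1) 1)
      = (\<Prod>j<n. if j = i then image_vec n A j else 1)"
    unfolding sym_map_monomial by (intro prod.cong) (auto simp: lookup_single when_def)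
  then show ?thesis using assms by simp
qed

lemma sym_map_compose:
  assumes A: "A \<in> carrier_mat n n" and B: "B \<in> carrier_mat n n"
  shows "sym_map n (A * B) p = sym_map n A (sym_map n B p)"
proof -
  have sc: "single \<alpha> c = poly_scale c (single \<alpha> 1)" for \<alpha> c by (simp add: poly_scale_def mult_single)
  have vec: "sym_map n A (image_vec n B j) = image_vec n (A * B) j" if "j < n" for j
  proof -
    have "sym_map n A (image_vec n B j)
        = (\<Sum>i<n. poly_scale (B $$ (i, j)) (sym_map n A (single (single i 1) 1)))"
      unfolding image_vec_def sym_map_sum
      by (intro sum.cong refl) (subst sc, simp add: sym_map_scale)
    also have "\<dots> = (\<Sum>i<n. \<Sum>l<n. poly_scale (B $$ (i, j)) (single (single l 1) (A $$ (l, i))))"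
      by (intro sum.cong refl)
        (use sym_map_var in \<open>auto simp: image_vec_def cpoly.scale_sum_right\<close>)
    also have "\<dots> = (\<Sum>l<n. \<Sum>i<n. single (single l 1) (A $$ (l, i) * B $$ (i, j)))"
      by (subst sum.swap) (simp add: poly_scale_def mult_single mult.commute)
    also have "\<dots> = (\<Sum>l<n. single (single l 1) (\<Sum>i<n. A $$ (l, i) * B $$ (i, j)))"
    proof (intro sum.cong refl)
      fix l :: nat
      have "(\<Sum>i\<in>S. single (single l (1 :: nat)) (f i)) = single (single l 1) (\<Sum>i\<in>S. f i)"
        for S :: "nat set" and f :: "nat \<Rightarrow> complex"
        by (induction S rule: infinite_finite_induct) (simp_all add: single_add)
      then show "(\<Sum>i<n. single (single l (1 :: nat)) (A $$ (l, i) * B $$ (i, j)))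
        = single (single l 1) (\<Sum>i<n. A $$ (l, i) * B $$ (i, j))" .
    qed
    also have "\<dots> = image_vec n (A * B) j"
      unfolding image_vec_def using A B that
      by (intro sum.cong refl) (simp add: scalar_prod_def lessThan_atLeast0)
    finally show ?thesis .
  qed
  have "sym_map n A (sym_map n B p)
      = (\<Sum>\<alpha>\<in>keys p. poly_scale (lookup p \<alpha>) (\<Prod>j<n. sym_map n A (image_vec n B j) ^ lookup \<alpha> j))"
    by (simp add: sym_map_def[of n B] sym_map_sum sym_map_scale sym_map_prod sym_map_pow)
  also have "\<dots> = sym_map n (A * B) p"
    unfolding sym_map_def[of n "A * B"] by (simp add: vec)
  finally show ?thesis by simp
qed

lemma trace_sym_map_commute:
  assumes A: "A \<in> carrier_mat n n" and B: "B \<in> carrier_mat n n"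
  shows "cpoly.trace_on (sym_power n r) (sym_map n (A * B))
       = cpoly.trace_on (sym_power n r) (sym_map n (B * A))"
proof -
  define M where "M A \<alpha> \<beta> = lookup (sym_map n A (single \<beta> 1)) \<alpha>" for A \<alpha> \<beta>
  have M: "M (A * B) \<alpha> \<alpha> = (\<Sum>\<gamma>\<in>sym_exponents n r. M A \<alpha> \<gamma> * M B \<gamma> \<alpha>)"
    if "A \<in> carrier_mat n n" "B \<in> carrier_mat n n" "\<alpha> \<in> sym_exponents n r" for A B \<alpha>
  proof -
    have *: "sym_map n B (single \<alpha> 1) \<in> sym_power n r"
      using that by (intro sym_map_closed) (auto simp: sym_power_def)
    have "sym_map n A (sym_map n B (single \<alpha> 1))
      = sym_map n A (\<Sum>\<gamma>\<in>sym_exponents n r. poly_scale (M B \<gamma> \<alpha>) (single \<gamma> 1))"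
      unfolding M_def using * by (subst poly_expand) (auto simp: finite_sym_exponents sym_power_def)
    also have "\<dots> = (\<Sum>\<gamma>\<in>sym_exponents n r. poly_scale (M B \<gamma> \<alpha>) (sym_map n A (single \<gamma> 1)))"
      by (simp add: sym_map_sum sym_map_scale)
    finally have "lookup (sym_map n (A * B) (single \<alpha> 1)) \<alpha>
      = (\<Sum>\<gamma>\<in>sym_exponents n r. M B \<gamma> \<alpha> * M A \<alpha> \<gamma>)"
      using that by (simp add: sym_map_compose lookup_sum M_def)
    then show ?thesis by (simp add: M_def mult.commute)
  qed
  have "(\<Sum>\<alpha>\<in>sym_exponents n r. M (A * B) \<alpha> \<alpha>) = (\<Sum>\<alpha>\<in>sym_exponents n r. M (B * A) \<alpha> \<alpha>)"
    using A B by (simp add: M) (subst sum.swap, simp add: mult.commute)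
  then show ?thesis by (simp add: trace_sym_map M_def)
qed

lemma gen_sym_group_carrier: "A \<in> gen_sym_group n k \<Longrightarrow> A \<in> carrier_mat n n"
  by (simp add: gen_sym_group_def)

lemma gen_sym_group_one: "1\<^sub>m n \<in> gen_sym_group n k"
  by (auto simp: gen_sym_group_def intro!: ex1I split: if_splits)

lemma gen_sym_group_perm:
  assumes "A \<in> gen_sym_group n k"
  obtains \<sigma> a where "\<sigma> permutes {..<n}" "\<And>i. i < n \<Longrightarrow> a i ^ k = 1 \<and> a i \<noteq> 0"
    "A = mat n n (\<lambda>(i, j). if j = \<sigma> i then a i else 0)"
proof -
  have A: "A \<in> carrier_mat n n" "\<And>i. i < n \<Longrightarrow> \<exists>!j. j < n \<and> A $$ (i, j) \<noteq> 0"
    "\<And>j. j < n \<Longrightarrow> \<exists>!i. i < n \<and> A $$ (i, j) \<noteq> 0"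
    "\<And>i j. i < n \<Longrightarrow> j < n \<Longrightarrow> A $$ (i, j) \<noteq> 0 \<Longrightarrow> A $$ (i, j) ^ k = 1"
    using assms by (auto simp: gen_sym_group_def)
  define \<sigma> where "\<sigma> i = (if i < n then THE j. j < n \<and> A $$ (i, j) \<noteq> 0 else i)" for i
  have \<sigma>: "\<sigma> i < n" "A $$ (i, \<sigma> i) \<noteq> 0" if "i < n" for i
    using theI'[OF A(2)[OF that]] that by (auto simp: \<sigma>_def)
  have uniq: "j = \<sigma> i" if "i < n" "j < n" "A $$ (i, j) \<noteq> 0" for i j
    using A(2)[OF that(1)] \<sigma>[OF that(1)] that by blast
  have "inj_on \<sigma> {..<n}"
    using A(3) \<sigma> by (intro inj_onI) (metis lessThan_iff)
  moreover from this have "\<sigma> ` {..<n} = {..<n}"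
    using \<sigma> by (intro endo_inj_surj) auto
  ultimately have "bij_betw \<sigma> {..<n} {..<n}" by (simp add: bij_betw_def)
  then have perm: "\<sigma> permutes {..<n}"
    by (rule bij_imp_permutes) (simp add: \<sigma>_def)
  show ?thesis
  proof (rule that[of \<sigma> "\<lambda>i. A $$ (i, \<sigma> i)"])
    show "A = mat n n (\<lambda>(i, j). if j = \<sigma> i then A $$ (i, \<sigma> i) else 0)"
      using A(1) uniq by (intro eq_matI) auto
  qed (use perm \<sigma> A(4) in auto)
qed

lemma gen_sym_group_mat:
  assumes \<sigma>: "\<sigma> permutes {..<n}" and a: "\<And>i. i < n \<Longrightarrow> a i ^ k = 1 \<and> a i \<noteq> 0"
  shows "mat n n (\<lambda>(i, j). if j = \<sigma> i then a i else 0) \<in> gen_sym_group n k"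
proof -
  have in_n: "\<sigma> i < n \<longleftrightarrow> i < n" for i using permutes_in_image[OF \<sigma>, of i] by simp
  have *: "\<exists>!i. i < n \<and> j = \<sigma> i" if "j < n" for j
    using that \<sigma> in_n unfolding permutes_def by metis
  show ?thesis
    unfolding gen_sym_group_def
  proof (intro CollectI conjI allI impI, goal_cases)
    case (2 i)
    then show ?case using in_n a by (intro ex1I[of _ "\<sigma> i"]) (auto split: if_splits)
  next
    case (3 j)
    from *[OF 3] obtain i where i: "i < n" "j = \<sigma> i"
      and uniq: "\<And>i'. i' < n \<Longrightarrow> j = \<sigma> i' \<Longrightarrow> i' = i" by blast
    show ?case
    proof (rule ex1I[of _ i])
      show "i < n \<and> mat n n (\<lambda>(i, j). if j = \<sigma> i then a i else 0) $$ (i, j) \<noteq> 0"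
        using 3 i a by simp
    next
      fix i' assume "i' < n \<and> mat n n (\<lambda>(i, j). if j = \<sigma> i then a i else 0) $$ (i', j) \<noteq> 0"
      then have "i' < n" "j = \<sigma> i'" using 3 by (cases "j = \<sigma> i'"; simp)+
      then show "i' = i" by (rule uniq)
    qed
  qed (use a in \<open>auto split: if_splits\<close>)
qed

lemma gen_sym_group_mult:
  assumes "A \<in> gen_sym_group n k" "B \<in> gen_sym_group n k"
  shows "A * B \<in> gen_sym_group n k"
proof -
  obtain \<sigma> a where \<sigma>: "\<sigma> permutes {..<n}" and a: "\<And>i. i < n \<Longrightarrow> a i ^ k = 1 \<and> a i \<noteq> 0"
    and A: "A = mat n n (\<lambda>(i, j). if j = \<sigma> i then a i else 0)"
    using gen_sym_group_perm[OF assms(1)] by blast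
  obtain \<tau> b where \<tau>: "\<tau> permutes {..<n}" and b: "\<And>i. i < n \<Longrightarrow> b i ^ k = 1 \<and> b i \<noteq> 0"
    and B: "B = mat n n (\<lambda>(i, j). if j = \<tau> i then b i else 0)"
    using gen_sym_group_perm[OF assms(2)] by blast
  have in_n: "\<sigma> i < n \<longleftrightarrow> i < n" for i using permutes_in_image[OF \<sigma>, of i] by simp
  have "A * B = mat n n (\<lambda>(i, j). if j = (\<tau> \<circ> \<sigma>) i then a i * b (\<sigma> i) else 0)"
  proof (rule eq_matI)
    fix i j
    assume "i < dim_row (mat n n (\<lambda>(i, j). if j = (\<tau> \<circ> \<sigma>) i then a i * b (\<sigma> i) else 0))"
      and "j < dim_col (mat n n (\<lambda>(i, j). if j = (\<tau> \<circ> \<sigma>) i then a i * b (\<sigma> i) else 0))"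
    then have ij: "i < n" "j < n" by auto
    have "(A * B) $$ (i, j) = row A i \<bullet> col B j" using ij by (simp add: A B)
    also have "\<dots> = (\<Sum>l = 0..<n. if l = \<sigma> i then a i * (if j = \<tau> l then b l else 0) else 0)"
      unfolding scalar_prod_def A B using ij by (intro sum.cong) auto
    also have "\<dots> = a i * (if j = \<tau> (\<sigma> i) then b (\<sigma> i) else 0)"
      using ij in_n by (subst sum.delta) auto
    finally show "(A * B) $$ (i, j)
        = mat n n (\<lambda>(i, j). if j = (\<tau> \<circ> \<sigma>) i then a i * b (\<sigma> i) else 0) $$ (i, j)"
      using ij by auto
  qed (auto simp: A B)
  also have "\<dots> \<in> gen_sym_group n k"
    using \<sigma> \<tau> a b in_n by (intro gen_sym_group_mat permutes_compose) (auto simp: power_mult_distrib)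
  finally show ?thesis .
qed

lemma finite_gen_sym_group:
  assumes "k \<ge> 1"
  shows "finite (gen_sym_group n k)"
proof -
  have roots: "finite {z :: complex. z ^ k = 1}" using assms finite_roots_unity by simp
  let ?F = "{f. \<forall>x. (x \<in> {..<n} \<times> {..<n} \<longrightarrow> f x \<in> insert 0 {z :: complex. z ^ k = 1}) \<and>
                     (x \<notin> {..<n} \<times> {..<n} \<longrightarrow> f x = 0)}"
  have "finite ?F" using roots by (intro finite_set_of_finite_funs) auto
  moreover have "gen_sym_group n k \<subseteq> mat n n ` ?F"
  proof
    fix A assume "A \<in> gen_sym_group n k"
    then have A: "A \<in> carrier_mat n n" "\<And>i j. i < n \<Longrightarrow> j < n \<Longrightarrow> A $$ (i, j) \<noteq> 0 \<Longrightarrow> A $$ (i, j) ^ k = 1"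
      by (auto simp: gen_sym_group_def)
    have "A = mat n n (\<lambda>x. if x \<in> {..<n} \<times> {..<n} then A $$ x else 0)"
      using A(1) by (intro eq_matI) auto
    moreover have "(\<lambda>x. if x \<in> {..<n} \<times> {..<n} then A $$ x else 0) \<in> ?F" using A(2) by auto
    ultimately show "A \<in> mat n n ` ?F" by blast
  qed
  ultimately show ?thesis by (meson finite_imageI finite_subset)
qed

lemma gen_sym_group_subgroup:
  assumes "k \<ge> 1"
  shows "subgroup (gen_sym_group n k) (units_of (ring_mat TYPE(complex) n ()))"
proof -
  let ?R = "ring_mat TYPE(complex) n ()"
  interpret R: monoid ?R
    by (simp add: ring.is_monoid ring_mat)
  have ops: "carrier ?R = carrier_mat n n" "mult ?R = (*)" "one ?R = 1\<^sub>m n"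
    by (simp_all add: ring_mat_simps)
  have inv: "\<exists>B\<in>gen_sym_group n k. B * A = 1\<^sub>m n \<and> A * B = 1\<^sub>m n" if AG: "A \<in> gen_sym_group n k" for A
  proof -
    obtain \<sigma> a where \<sigma>: "\<sigma> permutes {..<n}" and a: "\<And>i. i < n \<Longrightarrow> a i ^ k = 1 \<and> a i \<noteq> 0"
      and A: "A = mat n n (\<lambda>(i, j). if j = \<sigma> i then a i else 0)"
      using gen_sym_group_perm[OF AG] by blast
    define \<tau> where "\<tau> = Hilbert_Choice.inv \<sigma>"
    have \<tau>: "\<tau> permutes {..<n}" using \<sigma> by (simp add: \<tau>_def permutes_inv)
    have \<sigma>\<tau>: "\<sigma> (\<tau> i) = i" "\<tau> (\<sigma> i) = i" for i
      using \<sigma> by (simp_all add: \<tau>_def permutes_inverses)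
    have in_n: "\<sigma> i < n \<longleftrightarrow> i < n" "\<tau> i < n \<longleftrightarrow> i < n" for i
      using permutes_in_image[OF \<sigma>, of i] permutes_in_image[OF \<tau>, of i] by simp_all
    define B where "B = mat n n (\<lambda>(i, j). if j = \<tau> i then inverse (a (\<tau> i)) else 0)"
    have B: "B \<in> gen_sym_group n k"
      unfolding B_def using \<tau> a in_n by (intro gen_sym_group_mat) (auto simp: power_inverse)
    have "A * B = 1\<^sub>m n"
    proof (rule eq_matI)
      fix i j assume "i < dim_row (1\<^sub>m n :: complex mat)" "j < dim_col (1\<^sub>m n :: complex mat)"
      then have ij: "i < n" "j < n" by auto
      have "(A * B) $$ (i, j) = row A i \<bullet> col B j" using ij by (simp add: A B_def)
      also have "\<dots>
          = (\<Sum>l = 0..<n. if l = \<sigma> i then a i * (if j = \<tau> l then inverse (a (\<tau> l)) else 0) else 0)"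
        unfolding scalar_prod_def A B_def using ij by (intro sum.cong) auto
      also have "\<dots> = a i * (if j = i then inverse (a i) else 0)"
        using ij in_n by (subst sum.delta) (auto simp: \<sigma>\<tau>)
      finally show "(A * B) $$ (i, j) = 1\<^sub>m n $$ (i, j)" using ij a by auto
    qed (auto simp: A B_def)
    moreover have "B * A = 1\<^sub>m n"
    proof (rule eq_matI)
      fix i j assume "i < dim_row (1\<^sub>m n :: complex mat)" "j < dim_col (1\<^sub>m n :: complex mat)"
      then have ij: "i < n" "j < n" by auto
      have "(B * A) $$ (i, j) = row B i \<bullet> col A j" using ij by (simp add: A B_def)
      also have "\<dots>
          = (\<Sum>l = 0..<n. if l = \<tau> i then inverse (a (\<tau> i)) * (if j = \<sigma> l then a l else 0) else 0)"
        unfolding scalar_prod_def A B_def using ij by (intro sum.cong) auto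
      also have "\<dots> = inverse (a (\<tau> i)) * (if j = i then a (\<tau> i) else 0)"
        using ij in_n by (subst sum.delta) (auto simp: \<sigma>\<tau>)
      finally show "(B * A) $$ (i, j) = 1\<^sub>m n $$ (i, j)" using ij a in_n by auto
    qed (auto simp: A B_def)
    ultimately show ?thesis using B by blast
  qed
  have sub: "gen_sym_group n k \<subseteq> Units ?R"
    using inv gen_sym_group_carrier by (auto simp: Units_def ops) blast
  interpret U: group "units_of ?R" by (rule R.units_group)
  show ?thesis
  proof (rule U.subgroupI)
    show "gen_sym_group n k \<subseteq> carrier (units_of ?R)" using sub by (simp add: units_of_def)
    show "gen_sym_group n k \<noteq> {}" using gen_sym_group_one by blast
  next
    fix A assume A: "A \<in> gen_sym_group n k"
    then obtain B where B: "B \<in> gen_sym_group n k" "B * A = 1\<^sub>m n" "A * B = 1\<^sub>m n" using inv by blast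
    have "inv\<^bsub>units_of ?R\<^esub> A = B"
      by (rule U.inv_equality) (use A B sub in \<open>auto simp: units_of_def ops\<close>)
    then show "inv\<^bsub>units_of ?R\<^esub> A \<in> gen_sym_group n k" using B by simp
  next
    fix A B assume "A \<in> gen_sym_group n k" "B \<in> gen_sym_group n k"
    then show "A \<otimes>\<^bsub>units_of ?R\<^esub> B \<in> gen_sym_group n k"
      by (simp add: units_of_def ops gen_sym_group_mult)
  qed
qed

lemma sym_char_class_function: "sym_char n k r \<in> class_functions n k"
proof -
  have "cpoly.trace_on (sym_power n r) (sym_map n (P * A * Q))
      = cpoly.trace_on (sym_power n r) (sym_map n A)"
    if "A \<in> gen_sym_group n k" "P \<in> gen_sym_group n k" "Q \<in> gen_sym_group n k" "P * Q = 1\<^sub>m n" for A P Q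
  proof -
    have c: "A \<in> carrier_mat n n" "P \<in> carrier_mat n n" "Q \<in> carrier_mat n n"
      using that gen_sym_group_carrier by blast+
    have "cpoly.trace_on (sym_power n r) (sym_map n (P * A * Q))
        = cpoly.trace_on (sym_power n r) (sym_map n (P * (A * Q)))"
      using c by (simp add: assoc_mult_mat[of P n n A n Q n])
    also have "\<dots> = cpoly.trace_on (sym_power n r) (sym_map n (A * Q * P))"
      using c by (intro trace_sym_map_commute) auto
    also have "A * Q * P = A"
      using c mat_mult_left_right_inverse[OF c(2,3) that(4)]
      by (simp add: assoc_mult_mat[of A n n Q n P n])
    finally show ?thesis .
  qed
  then show ?thesis by (auto simp: class_functions_def sym_char_def gen_sym_group_mult)
qed

text \<open>
  \<open>dim\<close> is \<open>0\<close> on infinite-dimensional spaces; the following shows that this case does not occur.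
\<close>

lemma char_span_finite_dim:
  assumes "k \<ge> 1"
  obtains B where "finite B" "cfun.independent B"
    "cfun.span B = cfun.span {sym_char n k r | r. True}" "char_span_dim n k = card B"
proof -
  define I where "I = (\<lambda>A :: complex mat. (\<lambda>x. if x = A then 1 else 0 :: complex)) ` gen_sym_group n k"
  have I: "finite I" by (simp add: I_def finite_gen_sym_group[OF assms])
  have sum_apply: "(\<Sum>x\<in>S. g x) y = (\<Sum>x\<in>S. g x y)" for S and g :: "complex mat \<Rightarrow> complex mat \<Rightarrow> complex" and y
    by (induction S rule: infinite_finite_induct) auto
  have sub: "sym_char n k r \<in> cfun.span I" for r
  proof -
    have "sym_char n k r
        = (\<Sum>A\<in>gen_sym_group n k. fun_scale (sym_char n k r A) (\<lambda>x. if x = A then 1 else 0))"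
    proof
      fix y
      have "(\<Sum>A\<in>gen_sym_group n k. sym_char n k r A * (if y = A then 1 else 0))
          = (\<Sum>A\<in>gen_sym_group n k. if A = y then sym_char n k r A else 0)"
        by (intro sum.cong) auto
      also have "\<dots> = sym_char n k r y"
        using finite_gen_sym_group[OF assms] by (auto simp: sym_char_def)
      finally show "sym_char n k r y
        = (\<Sum>A\<in>gen_sym_group n k. fun_scale (sym_char n k r A) (\<lambda>x. if x = A then 1 else 0)) y"
        by (simp add: sum_apply fun_scale_def)
    qed
    also have "\<dots> \<in> cfun.span I"
      by (intro cfun.span_sum cfun.span_scale cfun.span_base) (auto simp: I_def)
    finally show ?thesis .
  qed
  let ?C = "{sym_char n k r | r. True}"
  obtain B where B: "B \<subseteq> ?C" "cfun.independent B" "?C \<subseteq> cfun.span B"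
    using cfun.maximal_independent_subset[of ?C] by metis
  have "B \<subseteq> cfun.span I" using B(1) sub by blast
  then have "finite B" using cfun.independent_span_bound[OF I B(2)] by simp
  moreover have sp: "cfun.span B = cfun.span ?C"
    using B(1,3) by (simp add: cfun.span_eq) (meson cfun.span_base subset_iff)
  moreover have "char_span_dim n k = card B"
    unfolding char_span_dim_def
    by (rule cfun.dim_eq_card[OF _ B(2)]) (simp add: sp cfun.span_span)
  ultimately show ?thesis using that B(2) by blast
qed

end

theory Submission
  imports Defs "HOL-Combinatorics.Orbits" "HOL-Computational_Algebra.Polynomial_FPS"
begin

text \<open>
  A monomial matrix \<open>A\<close> scales exactly those monomials whose exponents are constant on the cycles
  \<open>c\<close> of its permutation, so \<open>\<Sum>\<^sub>r \<chi>\<^sub>r(A) t\<^sup>r = \<Prod>\<^sub>c 1 / (1 - \<epsilon>\<^sub>c t\<^bsup>|c|\<^esup>)\<close>, where \<open>\<epsilon>\<^sub>c\<close>, the product of the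
  entries of \<open>A\<close> along \<open>c\<close>, is a \<open>k\<close>-th root of unity. The denominator has degree \<open>n\<close> and divides
  \<open>Q = \<Prod>\<^sub>j (1 - t\<^bsup>kj\<^esup>)\<close> with \<open>1 \<le> j \<le> n\<close>: cut \<open>{1..n}\<close> into consecutive intervals of lengths \<open>|c|\<close>;
  the interval of \<open>c\<close> contains a multiple \<open>j\<close> of \<open>|c|\<close>, and \<open>1 - \<epsilon>\<^sub>c t\<^bsup>|c|\<^esup>\<close> divides \<open>1 - t\<^bsup>kj\<^esup>\<close>.
  Hence \<open>Q \<Sum>\<^sub>r \<chi>\<^sub>r t\<^sup>r\<close> is a polynomial in \<open>t\<close> of degree at most \<open>M = k n (n + 1) / 2 - n\<close> with
  functions \<open>\<psi>\<^sub>s\<close> on the group as coefficients, and dividing by \<open>Q\<close> expresses every \<open>\<chi>\<^sub>r\<close> through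
  \<open>\<psi>\<^sub>0, \<dots>, \<psi>\<^sub>M\<close>.
\<close>

no_notation vec_index (infixl "$" 100)
unbundle fps_syntax

section \<open>Denominators: cycle polynomials and their common multiple\<close>

definition cycle_poly :: "(nat \<Rightarrow> complex) \<Rightarrow> nat set \<Rightarrow> complex poly" where
  "cycle_poly a c = 1 - monom (\<Prod>i\<in>c. a i) (card c)"

definition common_denom :: "nat \<Rightarrow> nat \<Rightarrow> complex poly" where
  "common_denom n k = (\<Prod>j=1..n. 1 - monom 1 (k * j))"

lemma degree_one_minus_monom:
  assumes "c \<noteq> 0" "m \<ge> 1"
  shows "degree (1 - monom c m :: 'a :: idom poly) = m"
proof (rule antisym)
  show "degree (1 - monom c m) \<le> m"
    by (intro degree_diff_le) (auto simp: degree_monom_le)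
  show "m \<le> degree (1 - monom c m)"
    using assms by (intro le_degree) auto
qed

text \<open>With x = c t^l, the polynomial 1 - x divides 1 - x^(k q), and \<open>c ^ k = 1\<close>
  removes the scalar from that power.\<close>

lemma one_minus_monom_dvd:
  assumes "c ^ k = 1"
  shows "(1 - monom c l :: 'a :: comm_ring_1 poly) dvd 1 - monom 1 (k * (l * q))"
proof -
  have "monom 1 (k * (l * q)) = monom c l ^ (k * q)"
    by (simp add: monom_power assms power_mult mult_ac)
  then show ?thesis
    by (simp add: one_diff_power_eq)
qed

lemma multiple_in_interval:
  fixes l N :: nat
  assumes "l \<ge> 1"
  obtains q where "l * q \<in> {N+1..N+l}"
proof
  \<comment> \<open>The witness is the first multiple of \<open>l\<close> beyond \<open>N\<close>;
    it exceeds \<open>N\<close> by \<open>l - N mod l\<close>.\<close>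
  have "l * (N div l + 1) = N - N mod l + l"
    by (simp add: minus_mod_eq_mult_div)
  moreover have "N mod l < l" "N mod l \<le> N" using assms by auto
  ultimately show "l * (N div l + 1) \<in> {N+1..N+l}" by auto
qed

text \<open>Cycle polynomials may share roots, so it would not suffice that each of them divides
  \<open>common_denom\<close>. Giving the blocks pairwise disjoint intervals of indices lets the
  divisibilities be multiplied; the induction appends the interval of the new block.\<close>

lemma cycle_polys_dvd_common_denom:
  assumes "finite C"
    and "\<And>c. c \<in> C \<Longrightarrow> finite c \<and> c \<noteq> {} \<and> (\<Prod>i\<in>c. a i) ^ k = 1"
  shows "(\<Prod>c\<in>C. cycle_poly a c) dvd common_denom (\<Sum>c\<in>C. card c) k"
  using assms
proof (induction C rule: finite_induct)
  case empty
  then show ?case by simp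
next
  case (insert c C)
  define N where "N = (\<Sum>c\<in>C. card c)"
  have "card c \<ge> 1" using insert.prems[of c] by (simp add: Suc_le_eq card_gt_0_iff)
  then obtain q where q: "card c * q \<in> {N+1..N+card c}" by (rule multiple_in_interval)
  have "cycle_poly a c dvd 1 - monom 1 (k * (card c * q))"
    unfolding cycle_poly_def using insert.prems[of c] by (intro one_minus_monom_dvd) auto
  also have "\<dots> dvd (\<Prod>j=N+1..N+card c. 1 - monom 1 (k * j))"
    using q by (intro dvd_prodI) auto
  finally have c: "cycle_poly a c dvd (\<Prod>j=N+1..N+card c. 1 - monom 1 (k * j))" .
  have "{1..N+card c} = {1..N} \<union> {N+1..N+card c}" by auto
  then have "common_denom (N + card c) k
      = common_denom N k * (\<Prod>j=N+1..N+card c. 1 - monom 1 (k * j))"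
    unfolding common_denom_def by (simp only:) (intro prod.union_disjoint, auto)
  moreover have "(\<Prod>c\<in>C. cycle_poly a c) dvd common_denom N k"
    unfolding N_def using insert by blast
  ultimately have "(\<Prod>c\<in>C. cycle_poly a c) * cycle_poly a c dvd common_denom (N + card c) k"
    using c by (simp add: mult_dvd_mono)
  then show ?case using insert.hyps by (simp add: N_def mult.commute add.commute)
qed

lemma degree_common_denom:
  assumes "k \<ge> 1"
  shows "degree (common_denom n k) = (\<Sum>j=1..n. k * j)"
proof -
  have d: "degree (1 - monom 1 (k * j) :: complex poly) = k * j" if "j \<in> {1..n}" for j
    using that assms by (intro degree_one_minus_monom) (auto simp: Suc_le_eq)
  then have "1 - monom 1 (k * j) \<noteq> (0 :: complex poly)" if "j \<in> {1..n}" for j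
    using d[OF that] that assms by (metis One_nat_def atLeastAtMost_iff degree_0 mult_eq_0_iff not_one_le_zero)
  then show ?thesis
    unfolding common_denom_def using d by (subst degree_prod_sum_eq) (auto intro: sum.cong)
qed

text \<open>Constant term 1 makes the denominator nonzero and invertible as a power series.\<close>

lemma coeff_0_common_denom: "k \<ge> 1 \<Longrightarrow> coeff (common_denom n k) 0 = 1"
  unfolding common_denom_def poly_0_coeff_0[symmetric] poly_prod
  by (intro prod.neutral) (auto simp: poly_monom zero_power)

section \<open>Generating series of exponent vectors constant on blocks\<close>

definition block_functions :: "nat set set \<Rightarrow> nat \<Rightarrow> (nat \<Rightarrow> nat) set" where
  "block_functions C r = {f. (\<forall>i. i \<notin> \<Union>C \<longrightarrow> f i = 0) \<and>
     (\<forall>c\<in>C. \<forall>i\<in>c. \<forall>j\<in>c. f i = f j) \<and> (\<Sum>i\<in>\<Union>C. f i) = r}"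

lemma block_functionsD:
  assumes "f \<in> block_functions C r"
  shows "i \<notin> \<Union>C \<Longrightarrow> f i = 0" and "c \<in> C \<Longrightarrow> i \<in> c \<Longrightarrow> j \<in> c \<Longrightarrow> f i = f j"
    and "(\<Sum>i\<in>\<Union>C. f i) = r"
  using assms unfolding block_functions_def by blast+

text \<open>When the blocks are the cycles of a monomial matrix with entries \<open>a\<close>, each
  \<open>f\<close> is the exponent vector of a monomial that the matrix scales, and its weight is
  the eigenvalue. Coefficient \<open>r\<close> is then the trace on the \<open>r\<close>-th
  symmetric power.\<close>

definition block_series :: "(nat \<Rightarrow> complex) \<Rightarrow> nat set set \<Rightarrow> complex fps" where
  "block_series a C = Abs_fps (\<lambda>r. \<Sum>f\<in>block_functions C r. \<Prod>i\<in>\<Union>C. a i ^ f i)"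

lemma finite_block_functions:
  assumes "finite (\<Union>C)"
  shows "finite (block_functions C r)"
proof (rule finite_subset)
  show "block_functions C r \<subseteq>
      {f. \<forall>x. (x \<in> \<Union>C \<longrightarrow> f x \<in> {..r}) \<and> (x \<notin> \<Union>C \<longrightarrow> f x = 0)}"
    using assms by (auto simp: block_functions_def simp del: Union_iff intro: member_le_sum)
  show "finite \<dots>" using assms by (intro finite_set_of_finite_funs) auto
qed

lemma block_series_empty: "block_series a {} = 1"
proof (rule fps_ext)
  fix r
  have "block_functions {} r = (if r = 0 then {\<lambda>_. 0} else {})"
    by (auto simp: block_functions_def)
  then show "block_series a {} $ r = 1 $ r" by (simp add: block_series_def)
qed

text \<open>A function constant on \<open>c\<close> amounts to its value m there and its part on the
  other blocks. The value adds \<open>card c * m\<close> to the degree and multiplies the weight by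
  the m-th power of the product over \<open>c\<close>, so a geometric series splits off.\<close>

lemma block_series_insert:
  assumes "finite (\<Union>C)" "finite c" "c \<noteq> {}" "c \<inter> \<Union>C = {}"
  shows "block_series a (insert c C)
       = Abs_fps (\<lambda>r. if card c dvd r then (\<Prod>i\<in>c. a i) ^ (r div card c) else 0) * block_series a C"
    (is "_ = ?G * _")
proof (rule fps_ext)
  fix r
  let ?U = "\<Union>C" and ?l = "card c" and ?e = "\<Prod>i\<in>c. a i"
  let ?w = "\<lambda>D f. \<Prod>i\<in>D. a i ^ f i"
  \<comment> \<open>\<open>s\<close> is the share of the degree \<open>r\<close> spent on
    \<open>c\<close>; \<open>g\<close> lives on the other blocks and takes up the rest.\<close>
  let ?S = "SIGMA s:{s\<in>{..r}. ?l dvd s}. block_functions C (r - s)"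
  let ?h = "\<lambda>(s, g) i. if i \<in> c then s div ?l else g i"
  have l: "?l > 0" using assms by (simp add: card_gt_0_iff)
  obtain x where x: "x \<in> c" using assms by auto
  have U: "finite ?U" "i \<in> ?U \<Longrightarrow> i \<notin> c" for i using assms by auto
  have split: "(\<Sum>i\<in>\<Union>(insert c C). f i) = (\<Sum>i\<in>c. f i) + (\<Sum>i\<in>?U. f i)" for f :: "nat \<Rightarrow> nat"
    using assms by (simp add: sum.union_disjoint)
  have const: "(\<Sum>i\<in>c. f i) = ?l * f x" if "f \<in> block_functions (insert c C) r" for f
  proof -
    have "(\<Sum>i\<in>c. f i) = (\<Sum>i\<in>c. f x)"
      using x by (intro sum.cong refl block_functionsD(2)[OF that, of c]) auto
    then show ?thesis by simp
  qed
  have "block_series a (insert c C) $ r = (\<Sum>f\<in>block_functions (insert c C) r. ?w (\<Union>(insert c C)) f)"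
    by (simp add: block_series_def)
  \<comment> \<open>The bijection reads off the value on \<open>c\<close> at the representative
    \<open>x\<close> and sets \<open>f\<close> to zero on \<open>c\<close>; \<open>?h\<close> puts
    \<open>s div ?l\<close> back there.\<close>
  also have "\<dots> = (\<Sum>(s, g)\<in>?S. ?e ^ (s div ?l) * ?w ?U g)"
  proof (rule sum.reindex_bij_witness[where j = "\<lambda>f. (?l * f x, \<lambda>i. if i \<in> c then 0 else f i)" and i = ?h])
    fix f assume f: "f \<in> block_functions (insert c C) r"
    have fx: "f i = f x" if "i \<in> c" for i by (rule block_functionsD(2)[OF f, of c]) (use x that in auto)
    have tot: "?l * f x + (\<Sum>i\<in>?U. f i) = r"
      using block_functionsD(3)[OF f] const[OF f] by (simp only: split)
    have sU: "(\<Sum>i\<in>?U. if i \<in> c then 0 else f i) = (\<Sum>i\<in>?U. f i)"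
      using U by (intro sum.cong) auto
    show "?h (?l * f x, \<lambda>i. if i \<in> c then 0 else f i) = f"
      using l by (simp add: fun_eq_iff) (metis fx)
    have "(\<lambda>i. if i \<in> c then 0 else f i) \<in> block_functions C (r - ?l * f x)"
      unfolding block_functions_def
    proof (intro CollectI conjI ballI allI impI)
      fix i assume "i \<notin> ?U"
      then show "(if i \<in> c then 0 else f i) = 0" using block_functionsD(1)[OF f, of i] by auto
    next
      fix d i j assume "d \<in> C" "i \<in> d" "j \<in> d"
      moreover from this have "i \<notin> c" "j \<notin> c" using assms(4) by auto
      ultimately show "(if i \<in> c then 0 else f i) = (if j \<in> c then 0 else f j)"
        using block_functionsD(2)[OF f, of d i j] by simp
    next
      show "(\<Sum>i\<in>?U. if i \<in> c then 0 else f i) = r - ?l * f x"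
        using sU tot by simp
    qed
    then show "(?l * f x, \<lambda>i. if i \<in> c then 0 else f i) \<in> ?S"
      using tot by auto
    have "?w (\<Union>(insert c C)) f = ?w c f * ?w ?U f"
      using assms by (simp add: prod.union_disjoint)
    also have "?w c f = ?e ^ f x"
      unfolding prod_power_distrib by (intro prod.cong refl arg_cong2[where f = power] fx)
    also have "?w ?U f = ?w ?U (\<lambda>i. if i \<in> c then 0 else f i)"
      using U by (intro prod.cong) auto
    finally show "(case (?l * f x, \<lambda>i. if i \<in> c then 0 else f i) of
        (s, g) \<Rightarrow> ?e ^ (s div ?l) * ?w ?U g) = ?w (\<Union>(insert c C)) f"
      using l by simp
  next
    fix p assume "p \<in> ?S"
    then obtain s g where p: "p = (s, g)" "s \<le> r" "?l dvd s" "g \<in> block_functions C (r - s)" by auto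
    have g0: "g i = 0" if "i \<in> c" for i using block_functionsD(1)[OF p(4), of i] that assms(4) by blast
    have sU: "(\<Sum>i\<in>?U. if i \<in> c then s div ?l else g i) = (\<Sum>i\<in>?U. g i)"
      using U by (intro sum.cong) auto
    show "(?l * ?h p x, \<lambda>i. if i \<in> c then 0 else ?h p i) = p"
      using p x g0 by auto
    show "?h p \<in> block_functions (insert c C) r"
      unfolding block_functions_def
    proof (intro CollectI conjI ballI allI impI)
      fix i assume "i \<notin> \<Union>(insert c C)"
      then show "?h p i = 0" using block_functionsD(1)[OF p(4), of i] by (simp add: p(1))
    next
      fix d i j assume "d \<in> insert c C" "i \<in> d" "j \<in> d"
      then consider "d = c" | "d \<in> C" "i \<notin> c" "j \<notin> c" using assms(4) by auto
      then show "?h p i = ?h p j"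
        by cases (use \<open>i \<in> d\<close> \<open>j \<in> d\<close> block_functionsD(2)[OF p(4), of d i j] in \<open>simp_all add: p(1)\<close>)
    next
      show "(\<Sum>i\<in>\<Union>(insert c C). ?h p i) = r"
        unfolding split p(1) prod.case sU block_functionsD(3)[OF p(4)] using p(2,3) by simp
    qed
  qed
  also have "\<dots> = (\<Sum>s | s \<in> {..r} \<and> ?l dvd s. \<Sum>g\<in>block_functions C (r - s). ?e ^ (s div ?l) * ?w ?U g)"
    using finite_block_functions[OF U(1)] by (subst sum.Sigma) auto
  also have "\<dots> = (\<Sum>s | s \<in> {..r} \<and> ?l dvd s. ?e ^ (s div ?l) * block_series a C $ (r - s))"
    by (simp add: block_series_def sum_distrib_left)
  \<comment> \<open>Where \<open>?l\<close> does not divide \<open>s\<close>, the coefficient of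
    \<open>?G\<close> is 0.\<close>
  also have "\<dots> = (\<Sum>s=0..r. ?G $ s * block_series a C $ (r - s))"
    by (intro sum.mono_neutral_cong_left) auto
  also have "\<dots> = (?G * block_series a C) $ r"
    by (simp add: fps_mult_nth)
  finally show "block_series a (insert c C) $ r = (?G * block_series a C) $ r" .
qed

text \<open>The second factor is the geometric series in e t^l, where e is the product over
  \<open>c\<close> and l = \<open>card c\<close>. From degree l on, its coefficient at r is e times
  the one at r - l, so the two cancel.\<close>

lemma cycle_poly_inverse:
  assumes "finite c" "c \<noteq> {}"
  shows "fps_of_poly (cycle_poly a c)
       * Abs_fps (\<lambda>r. if card c dvd r then (\<Prod>i\<in>c. a i) ^ (r div card c) else 0) = 1"
    (is "?P * ?G = 1")
proof (rule fps_ext)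
  fix r
  let ?l = "card c" and ?e = "\<Prod>i\<in>c. a i"
  have l: "?l > 0" using assms by (simp add: card_gt_0_iff)
  have "?P * ?G = ?G - fps_const ?e * (fps_X ^ ?l * ?G)"
    by (simp add: cycle_poly_def fps_of_poly_diff fps_of_poly_monom algebra_simps)
  then have *: "(?P * ?G) $ r = ?G $ r - ?e * (if r < ?l then 0 else ?G $ (r - ?l))"
    by (simp add: fps_X_power_mult_nth)
  show "(?P * ?G) $ r = 1 $ r"
  proof (cases "r < ?l")
    case True
    \<comment> \<open>Below \<open>?l\<close> the only multiple of \<open>?l\<close> is 0, which
      yields the constant term 1.\<close>
    then show ?thesis using * l by (cases "r = 0") (auto dest: dvd_imp_le)
  next
    case False
    then have "r div ?l = Suc ((r - ?l) div ?l)" using l by (simp add: le_div_geq)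
    moreover have "?l dvd r - ?l \<longleftrightarrow> ?l dvd r" using False by (simp add: dvd_minus_self)
    ultimately show ?thesis using * False l by auto
  qed
qed

lemma block_series_mult_cycle_polys:
  assumes "finite C" "\<And>c. c \<in> C \<Longrightarrow> finite c \<and> c \<noteq> {}" "disjoint C"
  shows "fps_of_poly (\<Prod>c\<in>C. cycle_poly a c) * block_series a C = 1"
  using assms
proof (induction C rule: finite_induct)
  case empty
  then show ?case by (simp add: block_series_empty)
next
  case (insert c C)
  let ?G = "Abs_fps (\<lambda>r. if card c dvd r then (\<Prod>i\<in>c. a i) ^ (r div card c) else 0)"
  have "c \<inter> d = {}" if "d \<in> C" for d
    using insert.prems(2) insert.hyps(2) that by (intro disjointD[of "insert c C"]) auto
  then have "c \<inter> \<Union>C = {}" by auto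
  then have "block_series a (insert c C) = ?G * block_series a C"
    using insert by (intro block_series_insert) auto
  then have "fps_of_poly (\<Prod>c\<in>insert c C. cycle_poly a c) * block_series a (insert c C)
      = (fps_of_poly (cycle_poly a c) * ?G) * (fps_of_poly (\<Prod>c\<in>C. cycle_poly a c) * block_series a C)"
    using insert.hyps by (simp add: fps_of_poly_mult mult_ac)
  also have "\<dots> = 1"
    using insert by (simp add: cycle_poly_inverse pairwise_insert disjnt_def)
  finally show ?case .
qed

section \<open>Cycles of a permutation and traces of monomial matrices\<close>

lemma permutes_orbits:
  assumes "\<sigma> permutes {..<n::nat}"
  defines "C \<equiv> orbit \<sigma> ` {..<n}"
  shows "finite C" and "\<And>c. c \<in> C \<Longrightarrow> finite c \<and> c \<noteq> {}" and "disjoint C" and "\<Union>C = {..<n}"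
proof -
  have sub: "orbit \<sigma> i \<subseteq> {..<n}" if "i < n" for i
    using assms that by (intro permutes_orbit_subset) auto
  \<comment> \<open>\<open>orbit\<close> starts at \<open>\<sigma> i\<close>; that it returns to
    \<open>i\<close> relies on \<open>\<sigma>\<close> moving only finitely many points.\<close>
  have self: "i \<in> orbit \<sigma> i" for i
    using assms by (intro permutation_self_in_orbit) (auto simp: permutation_permutes)
  have eq: "orbit \<sigma> j = orbit \<sigma> i" if "j \<in> orbit \<sigma> i" for i j
    using assms that by (intro orbit_cyclic_eq3[OF cyclic_on_orbit]) auto
  show "finite C" by (simp add: C_def)
  show "finite c \<and> c \<noteq> {}" if "c \<in> C" for c
    using that sub self by (auto simp: C_def intro: finite_subset)
  show "disjoint C"
  proof (rule disjointI)
    fix c d assume "c \<in> C" "d \<in> C" "c \<noteq> d"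
    then show "c \<inter> d = {}" using eq unfolding C_def by blast
  qed
  show "\<Union>C = {..<n}" using sub self unfolding C_def by blast
qed

text \<open>The local condition \<open>f (\<sigma> i) = f i\<close> is what comparing a monomial
  with its image produces; induction along the orbit spreads it over the whole cycle.\<close>

lemma block_functions_orbits:
  assumes "\<sigma> permutes {..<n::nat}"
  shows "block_functions (orbit \<sigma> ` {..<n}) r
       = {f. (\<forall>i\<ge>n. f i = 0) \<and> (\<forall>i<n. f (\<sigma> i) = f i) \<and> (\<Sum>i<n. f i) = r}"
proof -
  have self: "i \<in> orbit \<sigma> i" for i
    using assms by (intro permutation_self_in_orbit) (auto simp: permutation_permutes)
  have "(\<forall>c\<in>orbit \<sigma> ` {..<n}. \<forall>i\<in>c. \<forall>j\<in>c. f i = f j) \<longleftrightarrow> (\<forall>i<n. f (\<sigma> i) = f i)" for f :: "nat \<Rightarrow> nat"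
  proof
    assume "\<forall>c\<in>orbit \<sigma> ` {..<n}. \<forall>i\<in>c. \<forall>j\<in>c. f i = f j"
    then show "\<forall>i<n. f (\<sigma> i) = f i" using self by (auto intro: orbit.base)
  next
    assume inv: "\<forall>i<n. f (\<sigma> i) = f i"
    have "f j = f i" if "i < n" "j \<in> orbit \<sigma> i" for i j
      using that(2)
    proof induction
      case base
      then show ?case using inv that(1) by simp
    next
      case (step y)
      have "y < n" using permutes_orbit_subset[OF assms, of i] step that(1) by auto
      then show ?case using inv step by simp
    qed
    then show "\<forall>c\<in>orbit \<sigma> ` {..<n}. \<forall>i\<in>c. \<forall>j\<in>c. f i = f j" by auto
  qed
  then show ?thesis
    unfolding block_functions_def permutes_orbits(4)[OF assms] by (auto simp: not_less)
qed

text \<open>The matrix sends the basis vector of index \<open>\<sigma> i\<close> to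
  \<open>a i\<close> times that of index \<open>i\<close>. A monomial thus goes to a multiple of the
  one with exponents permuted by \<open>\<sigma>\<close>, and it meets itself only if its exponents
  are invariant.\<close>

lemma lookup_sym_map_monomial:
  assumes \<sigma>: "\<sigma> permutes {..<n}"
    and A: "A = mat n n (\<lambda>(i, j). if j = \<sigma> i then a i else 0)"
    and \<alpha>: "keys \<alpha> \<subseteq> {..<n}"
  shows "lookup (sym_map n A (single \<alpha> 1)) \<alpha>
       = (if \<forall>i<n. lookup \<alpha> (\<sigma> i) = lookup \<alpha> i then \<Prod>i<n. a i ^ lookup \<alpha> i else 0)"
proof -
  have in_n: "\<sigma> i < n \<longleftrightarrow> i < n" for i using permutes_in_image[OF \<sigma>, of i] by simp
  have inj: "\<sigma> i = \<sigma> j \<longleftrightarrow> i = j" for i j using permutes_inj[OF \<sigma>] by (auto dest: injD)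
  \<comment> \<open>Column \<open>\<sigma> i\<close> has its only possibly nonzero entry in row
    \<open>i\<close>.\<close>
  have vec: "image_vec n A (\<sigma> i) = single (single i 1) (a i)" if "i < n" for i
  proof -
    have "image_vec n A (\<sigma> i) = (\<Sum>j<n. if j = i then single (single i 1) (a i) else 0)"
      unfolding image_vec_def using that in_n inj by (intro sum.cong) (auto simp: A)
    then show ?thesis using that by simp
  qed
  have pow: "single (single i 1) c ^ m = single (single i m) (c ^ m)" for i m :: nat and c :: complex
    by (induction m) (simp_all add: mult_single flip: single_add)
  have prod: "(\<Prod>i\<in>S. single (g i) (h i)) = single (\<Sum>i\<in>S. g i) (\<Prod>i\<in>S. h i)"
    for S :: "nat set" and g :: "nat \<Rightarrow> nat \<Rightarrow>\<^sub>0 nat" and h :: "nat \<Rightarrow> complex"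
    by (induction S rule: infinite_finite_induct) (simp_all add: mult_single)
  let ?\<beta> = "\<Sum>i<n. single i (lookup \<alpha> (\<sigma> i))"
  have "sym_map n A (single \<alpha> 1) = (\<Prod>j<n. image_vec n A j ^ lookup \<alpha> j)"
    by (rule sym_map_monomial)
  also have "\<dots> = (\<Prod>i<n. image_vec n A (\<sigma> i) ^ lookup \<alpha> (\<sigma> i))"
    using prod.permute[OF \<sigma>, of "\<lambda>j. image_vec n A j ^ lookup \<alpha> j"] by (simp add: comp_def)
  also have "\<dots> = single ?\<beta> (\<Prod>i<n. a i ^ lookup \<alpha> (\<sigma> i))"
    by (simp add: vec pow prod del: One_nat_def)
  finally have *: "sym_map n A (single \<alpha> 1) = single ?\<beta> (\<Prod>i<n. a i ^ lookup \<alpha> (\<sigma> i))" .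
  have \<beta>: "lookup ?\<beta> i = (if i < n then lookup \<alpha> (\<sigma> i) else 0)" for i
    by (simp add: lookup_sum lookup_single when_def)
  have "?\<beta> = \<alpha> \<longleftrightarrow> (\<forall>i<n. lookup \<alpha> (\<sigma> i) = lookup \<alpha> i)"
  proof
    assume "?\<beta> = \<alpha>"
    then show "\<forall>i<n. lookup \<alpha> (\<sigma> i) = lookup \<alpha> i" using \<beta> by metis
  next
    assume "\<forall>i<n. lookup \<alpha> (\<sigma> i) = lookup \<alpha> i"
    then have "lookup ?\<beta> i = lookup \<alpha> i" for i
      unfolding \<beta> using \<alpha> by (auto simp: in_keys_iff subset_eq)
    then show "?\<beta> = \<alpha>" by (rule poly_mapping_eqI)
  qed
  then show ?thesis by (auto simp: * lookup_single when_def)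
qed

text \<open>Only invariant exponents contribute to the diagonal sum, and \<open>lookup\<close>
  identifies them with the block functions of the cycles.\<close>

lemma trace_sym_map_eq_block_series:
  assumes \<sigma>: "\<sigma> permutes {..<n}"
    and A: "A = mat n n (\<lambda>(i, j). if j = \<sigma> i then a i else 0)"
  shows "cpoly.trace_on (sym_power n r) (sym_map n A) = block_series a (orbit \<sigma> ` {..<n}) $ r"
proof -
  let ?B = "block_functions (orbit \<sigma> ` {..<n}) r"
  let ?E = "{\<alpha> \<in> sym_exponents n r. \<forall>i<n. lookup \<alpha> (\<sigma> i) = lookup \<alpha> i}"
  have B: "?B = lookup ` ?E"
  proof
    show "?B \<subseteq> lookup ` ?E"
    proof
      fix f assume "f \<in> ?B"
      then have f: "\<forall>i\<ge>n. f i = 0" "\<forall>i<n. f (\<sigma> i) = f i" "(\<Sum>i<n. f i) = r"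
        unfolding block_functions_orbits[OF \<sigma>] by blast+
      have sub: "{i. f i \<noteq> 0} \<subseteq> {..<n}"
        by (intro subsetI, rule ccontr) (simp add: f(1))
      \<comment> \<open>Finite support is what makes \<open>f\<close> a genuine exponent
        vector.\<close>
      have lk: "lookup (Abs_poly_mapping f) = f"
        using finite_subset[OF sub] by (simp add: Abs_poly_mapping_inverse)
      then have "keys (Abs_poly_mapping f) \<subseteq> {..<n}"
        using sub by (simp add: keys.rep_eq)
      then have "Abs_poly_mapping f \<in> ?E"
        using f(2,3) by (simp only: lk sym_exponents_def mem_Collect_eq simp_thms)
      then show "f \<in> lookup ` ?E" by (rule rev_image_eqI) (simp only: lk)
    qed
    show "lookup ` ?E \<subseteq> ?B"
      unfolding block_functions_orbits[OF \<sigma>]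
    proof (intro subsetI CollectI; elim imageE CollectE conjE; intro conjI allI impI)
      fix f \<alpha> i assume "\<alpha> \<in> sym_exponents n r" "f = lookup \<alpha>" "n \<le> i"
      moreover from this have "i \<notin> keys \<alpha>" by (auto simp: sym_exponents_def)
      ultimately show "f i = 0" by (simp add: in_keys_iff)
    qed (simp_all add: sym_exponents_def)
  qed
  have inj: "inj_on lookup ?E"
    by (rule inj_onI) (rule poly_mapping_eqI, simp only:)
  have "cpoly.trace_on (sym_power n r) (sym_map n A)
      = (\<Sum>\<alpha>\<in>sym_exponents n r. if \<forall>i<n. lookup \<alpha> (\<sigma> i) = lookup \<alpha> i then \<Prod>i<n. a i ^ lookup \<alpha> i else 0)"
    unfolding trace_sym_map
    by (intro sum.cong refl lookup_sym_map_monomial[OF \<sigma> A]) (auto simp: sym_exponents_def)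
  also have "\<dots> = (\<Sum>\<alpha>\<in>?E. \<Prod>i<n. a i ^ lookup \<alpha> i)"
    by (intro sum.mono_neutral_cong_right) (auto simp: finite_sym_exponents)
  also have "\<dots> = (\<Sum>f\<in>?B. \<Prod>i<n. a i ^ f i)"
    unfolding B by (simp only: sum.reindex[OF inj] comp_def)
  also have "\<dots> = block_series a (orbit \<sigma> ` {..<n}) $ r"
    by (simp add: block_series_def permutes_orbits(4)[OF \<sigma>])
  finally show ?thesis .
qed

section \<open>Rational character series and the dimension bound\<close>

lemma sym_char_series_rational:
  assumes "k \<ge> 1" "A \<in> gen_sym_group n k"
  obtains R where "fps_of_poly (common_denom n k) * Abs_fps (\<lambda>r. sym_char n k r A) = fps_of_poly R"
    and "degree R + n = (\<Sum>j=1..n. k * j)"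
proof -
  obtain \<sigma> a where \<sigma>: "\<sigma> permutes {..<n}" and a: "\<And>i. i < n \<Longrightarrow> a i ^ k = 1 \<and> a i \<noteq> 0"
    and A: "A = mat n n (\<lambda>(i, j). if j = \<sigma> i then a i else 0)"
    using gen_sym_group_perm[OF assms(2)] by blast
  define C where "C = orbit \<sigma> ` {..<n}"
  note C = permutes_orbits[OF \<sigma>, folded C_def]
  let ?D = "\<Prod>c\<in>C. cycle_poly a c"
  have ser: "Abs_fps (\<lambda>r. sym_char n k r A) = block_series a C"
    using assms by (intro fps_ext) (simp add: sym_char_def trace_sym_map_eq_block_series[OF \<sigma> A] C_def)
  have cn: "c \<subseteq> {..<n}" if "c \<in> C" for c using that C(4) by blast
  have pow: "(\<Prod>i\<in>c. a i) ^ k = 1" if "c \<in> C" for c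
    unfolding prod_power_distrib using a cn[OF that] by (intro prod.neutral) auto
  \<comment> \<open>Nonzero leading coefficients give each cycle polynomial its full degree, so
    \<open>?D\<close> has degree exactly \<open>n\<close>.\<close>
  have nz: "(\<Prod>i\<in>c. a i) \<noteq> 0" if "c \<in> C" for c
    using pow[OF that] assms(1) by (auto simp: zero_power)
  have card: "(\<Sum>c\<in>C. card c) = n"
    using card_Union_disjoint[of C] C by auto
  have "?D dvd common_denom n k"
    using cycle_polys_dvd_common_denom[of C a k] C pow card by auto
  then obtain R where R: "common_denom n k = ?D * R" by (elim dvdE)
  have "common_denom n k \<noteq> 0" using coeff_0_common_denom[OF assms(1), of n] by auto
  then have RD: "?D \<noteq> 0" "R \<noteq> 0" using R by auto
  have "degree ?D = (\<Sum>c\<in>C. degree (cycle_poly a c))"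
    using RD(1) C(1) by (intro degree_prod_sum_eq) auto
  also have "\<dots> = n"
    unfolding card[symmetric] cycle_poly_def using C nz
    by (intro sum.cong refl degree_one_minus_monom) (auto simp: Suc_le_eq card_gt_0_iff)
  finally have "degree R + n = (\<Sum>j=1..n. k * j)"
    using degree_mult_eq[OF RD] R degree_common_denom[OF assms(1), of n] by simp
  \<comment> \<open>The cofactor \<open>R\<close> is the numerator, since \<open>?D\<close> cancels
    the series.\<close>
  moreover have "fps_of_poly (common_denom n k) * block_series a C
      = fps_of_poly R * (fps_of_poly ?D * block_series a C)"
    by (simp add: R fps_of_poly_mult mult_ac)
  then have "fps_of_poly (common_denom n k) * Abs_fps (\<lambda>r. sym_char n k r A) = fps_of_poly R"
    using block_series_mult_cycle_polys[OF C(1-3)] by (simp add: ser)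
  ultimately show ?thesis using that by blast
qed

lemma sum_fun_apply: "(\<Sum>x\<in>S. g x) y = (\<Sum>x\<in>S. g x y :: 'b :: comm_monoid_add)"
  by (induction S rule: infinite_finite_induct) auto

lemma char_span_dim_bound:
  assumes "k \<ge> 1"
  shows "char_span_dim n k \<le> (\<Sum>j=1..n. k * j) - n + 1"
proof -
  define M where "M = (\<Sum>j=1..n. k * j) - n"
  define Q where "Q = fps_of_poly (common_denom n k)"
  define \<psi> where "\<psi> s A = (Q * Abs_fps (\<lambda>r. sym_char n k r A)) $ s" for s A
  \<comment> \<open>These are coefficients of 1/Q. They do not depend on the matrix, so they serve
    as scalars in a linear combination of functions on the group.\<close>
  define h where "h r s = (if s \<le> r then inverse Q $ (r - s) else 0)" for r s
  have Q: "inverse Q * Q = 1"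
    using coeff_0_common_denom[OF assms] by (intro inverse_mult_eq_1) (simp add: Q_def)
  have \<psi>0: "\<psi> s A = 0" if "s > M" for s A
  proof (cases "A \<in> gen_sym_group n k")
    case True
    obtain R where "Q * Abs_fps (\<lambda>r. sym_char n k r A) = fps_of_poly R"
      and "degree R + n = (\<Sum>j=1..n. k * j)"
      unfolding Q_def by (rule sym_char_series_rational[OF assms True])
    then show ?thesis using that by (simp add: \<psi>_def M_def coeff_eq_0)
  next
    case False
    then have "Abs_fps (\<lambda>r. sym_char n k r A) = 0" by (intro fps_ext) (simp add: sym_char_def)
    then show ?thesis by (simp add: \<psi>_def)
  qed
  have expand: "sym_char n k r = (\<Sum>s\<le>M. fun_scale (h r s) (\<psi> s))" for r
  proof
    fix A
    let ?F = "Abs_fps (\<lambda>r. sym_char n k r A)"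
    have "sym_char n k r A = (inverse Q * (Q * ?F)) $ r"
      by (simp add: Q flip: mult.assoc)
    also have "\<dots> = ((Q * ?F) * inverse Q) $ r" by (simp add: mult.commute)
    also have "\<dots> = (\<Sum>s=0..r. \<psi> s A * inverse Q $ (r - s))"
      unfolding \<psi>_def by (rule fps_mult_nth)
    \<comment> \<open>A common range for both sums: terms with \<open>s > r\<close> vanish through
      \<open>h\<close>, those with \<open>s > M\<close> through \<open>\<psi>\<close>.\<close>
    also have "\<dots> = (\<Sum>s\<le>max r M. h r s * \<psi> s A)"
      by (intro sum.mono_neutral_cong_left) (auto simp: h_def)
    also have "\<dots> = (\<Sum>s\<le>M. h r s * \<psi> s A)"
      by (intro sum.mono_neutral_right) (auto simp: \<psi>0)
    finally show "sym_char n k r A = (\<Sum>s\<le>M. fun_scale (h r s) (\<psi> s)) A"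
      by (simp add: sum_fun_apply fun_scale_def)
  qed
  have "{sym_char n k r | r. True} \<subseteq> cfun.span (\<psi> ` {..M})"
  proof safe
    fix r
    show "sym_char n k r \<in> cfun.span (\<psi> ` {..M})"
      unfolding expand by (intro cfun.span_sum cfun.span_scale cfun.span_base) auto
  qed
  then have "char_span_dim n k \<le> card (\<psi> ` {..M})"
    unfolding char_span_dim_def by (subst cfun.dim_span) (intro cfun.dim_le_card, auto)
  also have "\<dots> \<le> M + 1" using card_image_le[of "{..M}" \<psi>] by simp
  finally show ?thesis by (simp add: M_def)
qed

theorem proposition3:
  fixes n k :: nat
  assumes "n \<ge> 1" and "k \<ge> 1"
  shows "real (char_span_dim n k) \<le> real k * real n ^ 2 / 2 + (real k / 2 - 1) * real n + 1"
proof -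
  let ?N = "\<Sum>j=1..n. k * j"
  \<comment> \<open>This ensures that the natural-number subtraction of \<open>n\<close> in the
    bound is not truncated.\<close>
  have "(\<Sum>j=1..n. 1) \<le> ?N" using assms(2) by (intro sum_mono) auto
  then have le: "n \<le> ?N" by simp
  have "real ?N = real k * (\<Sum>j=Suc 0..n. real j)" by (simp add: sum_distrib_left)
  also have "(\<Sum>j=Suc 0..n. real j) = real n * (real n + 1) / 2"
    using double_gauss_sum_from_Suc_0[of n, where 'a = real] by simp
  finally have "real ?N = real k * (real n * (real n + 1) / 2)" .
  moreover have "real (char_span_dim n k) \<le> real ?N - real n + 1"
    using char_span_dim_bound[OF assms(2), of n] le by linarith
  ultimately show ?thesis by (simp add: field_simps power2_eq_square)
qed

end
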